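(* For any poset $P$ and integers $n,l,t\in\mathbb{N}$ with $l\ge 1$, we have \[ \operatorname{RT}(\mathcal{B};n,P,l,t)\le \operatorname{RT}^{\sharp}(\mathcal{B};n,P,l,t). \] Moreover, equality holds if and only if there exists a poset $Q_0\subseteq B_n$ such that $Q_0$ is weakly $P$-free, $w(Q_0)<l$, and $|\mathcal{C}_t(Q_0)|=\operatorname{RT}^{\sharp}(\mathcal{B};n,P,l,t)$.
   Context: $\mathbb{N}$ is the set of positive integers. $B_n$ is the power set of $[n]=\{1,\dots,n\}$ ordered by inclusion, and $\mathcal{B}=\{B_n\}_{n\in\mathbb{N}}$ is the family of Boolean lattices. A subset $Q\subseteq B_n$ (possibly empty) is regarded as a poset with the induced order. A $t$-chain in a poset is a set of exactly $t$ distinct pairwise comparable elements, and $\mathcal{C}_t(Q)$ is the set of all $t$-chains of $Q$. The width $w(Q)$ is the size of a largest antichain (set of pairwise incomparable elements) of $Q$, with $w(\emptyset)=0$. An injection $f:P\to Q$ between posets is a weak embedding if $x\le y$ in $P$ implies $f(x)\le f(y)$ in $Q$, and a strong embedding if $x\le y$ in $P$ if and only if $f(x)\le f(y)$ in $Q$. A poset $Q$ is weakly (resp. strongly) $P$-free if there is no weak (resp. strong) embedding of $P$ into $Q$. $\operatorname{RT}(\mathcal{B};n,P,l,t)$ (resp. $\operatorname{RT}^{\sharp}(\mathcal{B};n,P,l,t)$) is the maximum of $|\mathcal{C}_t(Q)|$ over all posets $Q\subseteq B_n$ such that $Q$ is weakly (resp. strongly) $P$-free and $w(Q)<l$. *)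

theory Defs
  imports Main
begin

text \<open>A poset is represented by its reflexive order relation \<open>P\<close> with \<open>Partial_order P\<close>;
  its underlying set is then \<open>Field P\<close>.\<close>

definition weak_embedding :: "'a rel \<Rightarrow> 'b rel \<Rightarrow> ('a \<Rightarrow> 'b) \<Rightarrow> bool" where
  "weak_embedding P Q f \<longleftrightarrow> inj_on f (Field P) \<and> f ` Field P \<subseteq> Field Q \<and>
     (\<forall>x\<in>Field P. \<forall>y\<in>Field P. (x, y) \<in> P \<longrightarrow> (f x, f y) \<in> Q)"

definition strong_embedding :: "'a rel \<Rightarrow> 'b rel \<Rightarrow> ('a \<Rightarrow> 'b) \<Rightarrow> bool" where
  "strong_embedding P Q f \<longleftrightarrow> inj_on f (Field P) \<and> f ` Field P \<subseteq> Field Q \<and>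
     (\<forall>x\<in>Field P. \<forall>y\<in>Field P. (x, y) \<in> P \<longleftrightarrow> (f x, f y) \<in> Q)"

definition weakly_free :: "'a rel \<Rightarrow> 'b rel \<Rightarrow> bool" where
  "weakly_free P Q \<longleftrightarrow> (\<nexists>f. weak_embedding P Q f)"

definition strongly_free :: "'a rel \<Rightarrow> 'b rel \<Rightarrow> bool" where
  "strongly_free P Q \<longleftrightarrow> (\<nexists>f. strong_embedding P Q f)"

text \<open>The requirement \<open>C \<subseteq> Field Q\<close> is already implied by \<open>C \<in> Chains Q\<close>.\<close>

definition t_chains :: "nat \<Rightarrow> 'a rel \<Rightarrow> 'a set set" where
  "t_chains t Q = {C \<in> Chains Q. finite C \<and> card C = t}"

definition antichains :: "'a rel \<Rightarrow> 'a set set" where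
  "antichains Q = {A. A \<subseteq> Field Q \<and> (\<forall>x\<in>A. \<forall>y\<in>A. x \<noteq> y \<longrightarrow> (x, y) \<notin> Q \<and> (y, x) \<notin> Q)}"

text \<open>Meaningful for finite posets only. As the empty set is an antichain, the empty poset
  has width \<open>0\<close>.\<close>

definition width :: "'a rel \<Rightarrow> nat" where
  "width Q = Max (card ` antichains Q)"

definition boolean_lattice :: "nat \<Rightarrow> nat set set" where
  "boolean_lattice n = Pow {1..n}"

text \<open>The order induced by inclusion on a family \<open>Q\<close> of sets, seen as a poset with underlying
  set \<open>Q\<close>.\<close>

definition incl :: "'a set set \<Rightarrow> 'a set rel" where
  "incl Q = relation_of (\<subseteq>) Q"

text \<open>Both maxima are over finite sets of numbers, which are nonempty whenever \<open>Field P \<noteq> {}\<close>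
  and \<open>l \<ge> 1\<close> (take \<open>Q = {}\<close>). If \<open>Field P = {}\<close>, no \<open>Q\<close> is \<open>P\<close>-free and the maxima
  do not exist.\<close>

definition RT :: "nat \<Rightarrow> 'a rel \<Rightarrow> nat \<Rightarrow> nat \<Rightarrow> nat" where
  "RT n P l t = Max {card (t_chains t (incl Q)) | Q.
     Q \<subseteq> boolean_lattice n \<and> weakly_free P (incl Q) \<and> width (incl Q) < l}"

definition RT_sharp :: "nat \<Rightarrow> 'a rel \<Rightarrow> nat \<Rightarrow> nat \<Rightarrow> nat" where
  "RT_sharp n P l t = Max {card (t_chains t (incl Q)) | Q.
     Q \<subseteq> boolean_lattice n \<and> strongly_free P (incl Q) \<and> width (incl Q) < l}"

end

theory Submission
  imports Defs
begin

text \<open>A strong embedding is a weak embedding, so weakly \<open>P\<close>-free families are strongly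
  \<open>P\<close>-free, and \<open>RT\<close> maximises the number of \<open>t\<close>-chains over a subset of the
  families that \<open>RT_sharp\<close> ranges over. Hence the inequality. The smaller maximum is attained,
  so the two maxima agree exactly when the larger one is already a value of the smaller set. All
  that has to be checked is that both sets of values are finite, because \<open>boolean_lattice n\<close>
  is finite, and that the smaller one is nonempty, because the empty family is
  admissible: a nonempty \<open>P\<close> does not embed into it, and its width is
  \<open>0 < l\<close>.\<close>

lemma strong_embedding_imp_weak_embedding: "strong_embedding P Q f \<Longrightarrow> weak_embedding P Q f"
  by (simp add: strong_embedding_def weak_embedding_def)

lemma weakly_free_imp_strongly_free: "weakly_free P Q \<Longrightarrow> strongly_free P Q"
  unfolding weakly_free_def strongly_free_def using strong_embedding_imp_weak_embedding by metis

lemma incl_empty: "incl {} = {}"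
  by (simp add: incl_def relation_of_def)

lemma weakly_free_empty: "Field P \<noteq> {} \<Longrightarrow> weakly_free P {}"
  by (simp add: weakly_free_def weak_embedding_def)

lemma antichains_empty: "antichains {} = {{}}"
  by (auto simp: antichains_def)

lemma width_empty: "width {} = 0"
  by (simp add: width_def antichains_empty)

lemma finite_values_on_boolean_lattice:
  "finite {g Q | Q. Q \<subseteq> boolean_lattice n \<and> R Q}"
proof -
  have "finite (g ` Pow (boolean_lattice n))"
    by (simp add: boolean_lattice_def)
  then show ?thesis
    by (rule rev_finite_subset) auto
qed

lemma Max_subset_eq_iff_mem:
  fixes A B :: "'a::linorder set"
  assumes "A \<subseteq> B" "A \<noteq> {}" "finite B"
  shows "Max A = Max B \<longleftrightarrow> Max B \<in> A"
proof
  have "finite A"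
    using assms(1,3) by (rule finite_subset)
  show "Max B \<in> A" if "Max A = Max B"
    using Max_in[OF \<open>finite A\<close> assms(2)] that by simp
  show "Max A = Max B" if "Max B \<in> A"
    using Max_ge[OF \<open>finite A\<close> that] Max_mono[OF assms] by simp
qed

theorem theorem3p3:
  fixes P :: "'a rel" and n l t :: nat
  assumes "Partial_order P" and "Field P \<noteq> {}"
    and "n \<ge> 1" and "l \<ge> 1" and "t \<ge> 1"
  shows "RT n P l t \<le> RT_sharp n P l t \<and>
    (RT n P l t = RT_sharp n P l t \<longleftrightarrow>
      (\<exists>Q\<^sub>0. Q\<^sub>0 \<subseteq> boolean_lattice n \<and> weakly_free P (incl Q\<^sub>0) \<and> width (incl Q\<^sub>0) < l \<and>
        card (t_chains t (incl Q\<^sub>0)) = RT_sharp n P l t))"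
proof -
  define W where "W = {card (t_chains t (incl Q)) | Q.
     Q \<subseteq> boolean_lattice n \<and> weakly_free P (incl Q) \<and> width (incl Q) < l}"
  define S where "S = {card (t_chains t (incl Q)) | Q.
     Q \<subseteq> boolean_lattice n \<and> strongly_free P (incl Q) \<and> width (incl Q) < l}"
  have RT: "RT n P l t = Max W" and RT_sharp: "RT_sharp n P l t = Max S"
    by (simp_all add: RT_def W_def RT_sharp_def S_def)
  have "W \<subseteq> S"
  proof
    fix k
    assume "k \<in> W"
    then obtain Q where "k = card (t_chains t (incl Q))" "Q \<subseteq> boolean_lattice n"
        "weakly_free P (incl Q)" "width (incl Q) < l"
      unfolding W_def by auto
    then show "k \<in> S"
      unfolding S_def using weakly_free_imp_strongly_free[of P "incl Q"] by auto
  qed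
  have "weakly_free P (incl {})" "width (incl ({} :: nat set set)) < l"
    using \<open>Field P \<noteq> {}\<close> \<open>l \<ge> 1\<close>
    by (simp_all add: incl_empty weakly_free_empty width_empty)
  then have "card (t_chains t (incl ({} :: nat set set))) \<in> W"
    unfolding W_def by (intro CollectI exI[of _ "{}"]) simp
  then have "W \<noteq> {}"
    by blast
  have "finite S"
    unfolding S_def by (rule finite_values_on_boolean_lattice)
  have "Max W \<le> Max S"
    using \<open>W \<subseteq> S\<close> \<open>W \<noteq> {}\<close> \<open>finite S\<close> by (rule Max_mono)
  moreover have "Max W = Max S \<longleftrightarrow> Max S \<in> W"
    using \<open>W \<subseteq> S\<close> \<open>W \<noteq> {}\<close> \<open>finite S\<close> by (rule Max_subset_eq_iff_mem)
  moreover have "Max S \<in> W \<longleftrightarrow>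
      (\<exists>Q. Q \<subseteq> boolean_lattice n \<and> weakly_free P (incl Q) \<and> width (incl Q) < l \<and>
        card (t_chains t (incl Q)) = Max S)"
    unfolding W_def mem_Collect_eq by (intro iff_exI) auto
  ultimately show ?thesis
    unfolding RT RT_sharp by simp
qed

end
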